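(* Let $X$ and $Y$ be finite $T_0$-spaces. Then the non-Hausdorff join $X\oplus Y$ is collapsible if and only if $X$ or $Y$ is collapsible.
   Context: Finite $T_0$-spaces are identified with finite posets: for a finite $T_0$-space $X$, $U_x$ denotes the intersection of all open sets containing $x$, and $x\le y$ if and only if $x\in U_y$; the open sets are the down-sets and the closure of $\{x\}$ is $F_x=\{y: y\ge x\}$. The (non-Hausdorff) join $X\oplus Y$ is the disjoint union $X\sqcup Y$ keeping the given ordering within $X$ and $Y$ and setting $x\le y$ for every $x\in X$ and $y\in Y$. Write $\hat{U}_x=U_x\smallsetminus\{x\}$ and $\hat{F}_x=F_x\smallsetminus\{x\}$. A point $x$ is a weak point of $X$ if $\hat{U}_x$ or $\hat{F}_x$ is contractible (as a topological space, i.e. homotopy equivalent to a point). If $x$ is a weak point of $X$, there is an elementary collapse from $X$ to $X\smallsetminus\{x\}$; $X$ collapses to $Y$ if there is a (finite) sequence of elementary collapses which starts in $X$ and ends in $Y$. The space $X$ is collapsible if it collapses to a point. *)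

theory Defs
  imports "HOL-Analysis.Analysis"
begin

definition min_open :: "'a topology \<Rightarrow> 'a \<Rightarrow> 'a set" where
  "min_open X x = \<Inter>{U. openin X U \<and> x \<in> U}"

definition spec_le :: "'a topology \<Rightarrow> 'a \<Rightarrow> 'a \<Rightarrow> bool" where
  "spec_le X x y \<longleftrightarrow> x \<in> topspace X \<and> y \<in> topspace X \<and> x \<in> min_open X y"

definition up_set :: "'a topology \<Rightarrow> 'a \<Rightarrow> 'a set" where
  "up_set X x = {y. spec_le X x y}"

lemma up_set_eq_closure_of:
  "x \<in> topspace X \<Longrightarrow> up_set X x = X closure_of {x}"
  by (auto simp: up_set_def spec_le_def min_open_def closure_of_def)

definition downset_topology :: "'a set \<Rightarrow> ('a \<Rightarrow> 'a \<Rightarrow> bool) \<Rightarrow> 'a topology" where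
  "downset_topology A le =
     topology (\<lambda>U. U \<subseteq> A \<and> (\<forall>y\<in>U. \<forall>x\<in>A. le x y \<longrightarrow> x \<in> U))"

lemma openin_downset_topology:
  "openin (downset_topology A le) U \<longleftrightarrow> U \<subseteq> A \<and> (\<forall>y\<in>U. \<forall>x\<in>A. le x y \<longrightarrow> x \<in> U)"
proof -
  have "istopology (\<lambda>U. U \<subseteq> A \<and> (\<forall>y\<in>U. \<forall>x\<in>A. le x y \<longrightarrow> x \<in> U))"
    unfolding istopology_def by blast
  then show ?thesis
    by (simp add: downset_topology_def topology_inverse')
qed

lemma topspace_downset_topology [simp]: "topspace (downset_topology A le) = A"
  by (auto simp: topspace_def openin_downset_topology)

lemma downset_topology_spec_le:
  assumes "finite (topspace X)"
  shows "downset_topology (topspace X) (spec_le X) = X"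
proof -
  have fin: "finite {U. openin X U \<and> x \<in> U}" for x
    by (rule finite_subset[of _ "Pow (topspace X)"]) (use assms openin_subset in auto)
  have op: "openin X (min_open X x)" if "x \<in> topspace X" for x
    unfolding min_open_def by (rule openin_Inter) (use fin that in auto)
  have "openin X U \<longleftrightarrow> openin (downset_topology (topspace X) (spec_le X)) U" for U
  proof
    assume "openin X U"
    then show "openin (downset_topology (topspace X) (spec_le X)) U"
      using openin_subset by (auto simp: openin_downset_topology spec_le_def min_open_def)
  next
    assume U: "openin (downset_topology (topspace X) (spec_le X)) U"
    have "\<exists>T. openin X T \<and> y \<in> T \<and> T \<subseteq> U" if "y \<in> U" for y
    proof -
      have y: "y \<in> topspace X"
        using U that by (auto simp: openin_downset_topology)
      have "min_open X y \<subseteq> U"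
        using U that y openin_subset[OF op[OF y]] by (auto simp: openin_downset_topology spec_le_def)
      moreover have "y \<in> min_open X y"
        by (auto simp: min_open_def)
      ultimately show ?thesis
        using op[OF y] by blast
    qed
    then show "openin X U"
      by (subst openin_subopen) blast
  qed
  then show ?thesis
    by (simp add: topology_eq)
qed

fun join_le :: "'a topology \<Rightarrow> 'b topology \<Rightarrow> 'a + 'b \<Rightarrow> 'a + 'b \<Rightarrow> bool" where
  "join_le X Y (Inl x) (Inl x') \<longleftrightarrow> spec_le X x x'"
| "join_le X Y (Inr y) (Inr y') \<longleftrightarrow> spec_le Y y y'"
| "join_le X Y (Inl x) (Inr y) \<longleftrightarrow> x \<in> topspace X \<and> y \<in> topspace Y"
| "join_le X Y (Inr y) (Inl x) \<longleftrightarrow> False"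

definition nh_join :: "'a topology \<Rightarrow> 'b topology \<Rightarrow> ('a + 'b) topology" where
  "nh_join X Y = downset_topology (topspace X <+> topspace Y) (join_le X Y)"

lemma spec_le_nh_join: "spec_le (nh_join X Y) = join_le X Y"
proof (intro ext)
  fix p q :: "'a + 'b"
  let ?A = "topspace X <+> topspace Y"
  have refl: "join_le X Y a a" if "a \<in> ?A" for a
    using that by (cases a) (auto simp: spec_le_def min_open_def)
  have trans: "join_le X Y a c" if "join_le X Y a b" "join_le X Y b c" for a b c
    using that by (cases a; cases b; cases c) (auto simp: spec_le_def min_open_def)
  have field: "a \<in> ?A \<and> b \<in> ?A" if "join_le X Y a b" for a b
    using that by (cases a; cases b) (auto simp: spec_le_def)
  have down: "openin (nh_join X Y) {a. join_le X Y a q}"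
    using trans field unfolding nh_join_def openin_downset_topology by blast
  have top: "topspace (nh_join X Y) = ?A"
    by (simp add: nh_join_def)
  have "join_le X Y p q" if "spec_le (nh_join X Y) p q"
  proof -
    have "q \<in> ?A" "p \<in> min_open (nh_join X Y) q"
      using that top unfolding spec_le_def by blast+
    then show ?thesis
      using down refl[of q] unfolding min_open_def by blast
  qed
  moreover have "spec_le (nh_join X Y) p q" if "join_le X Y p q"
    using that field[OF that] unfolding spec_le_def min_open_def nh_join_def openin_downset_topology topspace_downset_topology
    by blast
  ultimately show "spec_le (nh_join X Y) p q = join_le X Y p q"
    by blast
qed

text \<open>
  The constant \<^const>\<open>contractible_space\<close> also holds for the empty space, which is not
  homotopy equivalent to a point: a minimal or maximal point must not become a weak point
  just because its punctured down-set or up-set is empty.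
\<close>

definition contractible_to_point :: "'a topology \<Rightarrow> bool" where
  "contractible_to_point X \<longleftrightarrow> X homotopy_equivalent_space (discrete_topology {()})"

lemma contractible_to_point_iff:
  "contractible_to_point X \<longleftrightarrow> contractible_space X \<and> topspace X \<noteq> {}"
proof (cases "topspace X = {}")
  case True
  then show ?thesis
    by (auto simp: contractible_to_point_def homotopy_equivalent_space_def continuous_map_def)
next
  case False
  let ?P = "discrete_topology {()}"
  obtain a where a: "a \<in> topspace X"
    using False by blast
  have pt: "contractible_space ?P"
    by (rule contractible_space_singleton)
  have "X homotopy_equivalent_space ?P" if X: "contractible_space X"
  proof -
    have f: "continuous_map X ?P (\<lambda>_. ())" and g: "continuous_map ?P X (\<lambda>_. a)"
      using a by simp_all
    have "homotopic_with (\<lambda>_. True) X X ((\<lambda>_. a) \<circ> (\<lambda>_. ())) id"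
      by (intro homotopic_into_contractible_space conjI X continuous_map_id
          continuous_map_compose[OF f g])
    moreover have "homotopic_with (\<lambda>_. True) ?P ?P ((\<lambda>_. ()) \<circ> (\<lambda>_. a)) id"
      by (intro homotopic_into_contractible_space conjI pt continuous_map_id
          continuous_map_compose[OF g f])
    ultimately show ?thesis
      unfolding homotopy_equivalent_space_def using f g by blast
  qed
  then show ?thesis
    unfolding contractible_to_point_def
    using False pt homotopy_equivalent_space_contractibility by blast
qed

definition weak_point :: "'a topology \<Rightarrow> 'a \<Rightarrow> bool" where
  "weak_point X x \<longleftrightarrow> x \<in> topspace X \<and>
     (contractible_to_point (subtopology X (min_open X x - {x})) \<or>
      contractible_to_point (subtopology X (up_set X x - {x})))"

definition elementary_collapse :: "'a topology \<Rightarrow> 'a topology \<Rightarrow> bool" where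
  "elementary_collapse X Z \<longleftrightarrow>
     (\<exists>x. weak_point X x \<and> Z = subtopology X (topspace X - {x}))"

definition collapses_to :: "'a topology \<Rightarrow> 'a topology \<Rightarrow> bool" where
  "collapses_to = elementary_collapse\<^sup>*\<^sup>*"

definition collapsible :: "'a topology \<Rightarrow> bool" where
  "collapsible X \<longleftrightarrow> (\<exists>Z a. collapses_to X Z \<and> topspace Z = {a})"

end

theory Submission
  imports Defs
begin

text \<open>
  Both directions come from one combinatorial principle.  Collapsing a finite space to a point and
  dismantling it by beat points have the same shape: points \<open>x\<close> are removed one after the
  other, each because the punctured down-set or the punctured up-set of \<open>x\<close> satisfies some
  condition; the predicate \<open>peelable\<close> captures this.  In the join, a point \<open>x\<close> of
  \<open>X\<close> keeps its punctured down-set, while its punctured up-set becomes its punctured up-set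
  in \<open>X\<close> joined with \<open>Y\<close>; the dual holds for a point of \<open>Y\<close>.  Hence, as soon as the
  condition itself holds for a join only if it holds for a factor, any step in the join is either a
  step in one factor, or it reveals that the other factor is already reducible to a point.
  Conversely, a reduction of one factor can be performed inside the join, and it leaves a cone,
  which reduces to its apex (\<open>peelable_join_iff\<close>).

  The principle is used twice.  For the condition "has a greatest (least) element" it shows that a
  join is dismantlable if and only if a factor is.  This feeds the second use, where the condition is
  "is dismantlable" and the conclusion is the claim on collapsibility.

  What remains is Stong's theorem that a finite \<open>T\<^sub>0\<close>-space is contractible if and only
  if it is dismantlable (\<open>contractible_iff_dismantlable\<close>).  Removing a beat point is a
  homotopy equivalence because pointwise comparable continuous maps are homotopic.  In the other
  direction, a space without beat points is rigid: no other continuous self-map is comparable to the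
  identity.  Along a homotopy \<open>h\<close> that starts at the identity, \<open>h\<^sub>s \<le> h\<^sub>t\<close> for all \<open>s\<close>
  near \<open>t\<close>, so by rigidity the set of times at which \<open>h\<^sub>t\<close> is the identity is both open and
  closed in the unit interval, hence everything; a null homotopy then forces a single point.
\<close>

section \<open>Reducing finite posets one point at a time\<close>

locale finite_poset =
  fixes A :: "'a set" and le :: "'a \<Rightarrow> 'a \<Rightarrow> bool"
  assumes finite: "finite A"
    and refl: "x \<in> A \<Longrightarrow> le x x"
    and trans: "x \<in> A \<Longrightarrow> y \<in> A \<Longrightarrow> z \<in> A \<Longrightarrow> le x y \<Longrightarrow> le y z \<Longrightarrow> le x z"
    and antisym: "x \<in> A \<Longrightarrow> y \<in> A \<Longrightarrow> le x y \<Longrightarrow> le y x \<Longrightarrow> x = y"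

lemma finite_poset_subset:
  assumes "finite_poset A le" "B \<subseteq> A"
  shows "finite_poset B le"
proof -
  interpret finite_poset A le by fact
  show ?thesis
    using assms(2) finite_subset[OF assms(2) finite] refl trans antisym
    by unfold_locales (blast intro: trans antisym)+
qed

lemma finite_poset_conversep:
  assumes "finite_poset A le"
  shows "finite_poset A le\<inverse>\<inverse>"
proof -
  interpret finite_poset A le by fact
  show ?thesis
    by unfold_locales (auto intro: finite refl trans antisym)
qed

definition strictly_below :: "('a \<Rightarrow> 'a \<Rightarrow> bool) \<Rightarrow> 'a set \<Rightarrow> 'a \<Rightarrow> 'a set" where
  "strictly_below le A x = {y \<in> A. le y x \<and> y \<noteq> x}"

definition strictly_above :: "('a \<Rightarrow> 'a \<Rightarrow> bool) \<Rightarrow> 'a set \<Rightarrow> 'a \<Rightarrow> 'a set" where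
  "strictly_above le A x = {y \<in> A. le x y \<and> y \<noteq> x}"

lemma below_above_subset: "strictly_below le A x \<subseteq> A" "strictly_above le A x \<subseteq> A"
  by (auto simp: strictly_below_def strictly_above_def)

definition has_greatest :: "('a \<Rightarrow> 'a \<Rightarrow> bool) \<Rightarrow> 'a set \<Rightarrow> bool" where
  "has_greatest le A \<longleftrightarrow> (\<exists>m\<in>A. \<forall>y\<in>A. le y m)"

definition has_least :: "('a \<Rightarrow> 'a \<Rightarrow> bool) \<Rightarrow> 'a set \<Rightarrow> bool" where
  "has_least le A \<longleftrightarrow> (\<exists>m\<in>A. \<forall>y\<in>A. le m y)"

lemma conversep_simps:
  "strictly_below le\<inverse>\<inverse> = strictly_above le" "strictly_above le\<inverse>\<inverse> = strictly_below le"
  "has_greatest le\<inverse>\<inverse> = has_least le" "has_least le\<inverse>\<inverse> = has_greatest le"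
  by (auto simp: fun_eq_iff strictly_below_def strictly_above_def has_greatest_def has_least_def)

text \<open>
  Keeping the conditions \<open>D\<close> and \<open>U\<close> on the punctured down-set and up-set as parameters lets one
  argument about joins serve beat points and weak points alike.
\<close>

inductive peelable ::
  "('a set \<Rightarrow> bool) \<Rightarrow> ('a set \<Rightarrow> bool) \<Rightarrow> ('a \<Rightarrow> 'a \<Rightarrow> bool) \<Rightarrow> 'a set \<Rightarrow> bool"
  for D U le where
  singleton: "peelable D U le {a}"
| remove: "x \<in> A \<Longrightarrow> D (strictly_below le A x) \<or> U (strictly_above le A x) \<Longrightarrow> peelable D U le (A - {x})
    \<Longrightarrow> peelable D U le A"

abbreviation dismantlable :: "('a \<Rightarrow> 'a \<Rightarrow> bool) \<Rightarrow> 'a set \<Rightarrow> bool" where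
  "dismantlable le \<equiv> peelable (has_greatest le) (has_least le) le"

lemma peelable_mono:
  assumes "peelable D U le A" "finite_poset A le"
    and "\<And>B. B \<subseteq> A \<Longrightarrow> D B \<Longrightarrow> D' B" "\<And>B. B \<subseteq> A \<Longrightarrow> U B \<Longrightarrow> U' B"
  shows "peelable D' U' le A"
  using assms
proof induction
  case (singleton a)
  show ?case by (rule peelable.singleton)
next
  case (remove x A)
  have "finite_poset (A - {x}) le"
    using remove.prems(1) by (rule finite_poset_subset) auto
  then have "peelable D' U' le (A - {x})"
    using remove.IH remove.prems by (meson Diff_subset order_trans)
  moreover have "strictly_below le A x \<subseteq> A" "strictly_above le A x \<subseteq> A"
    by (fact below_above_subset)+
  ultimately show ?case
    using remove.hyps(1,2) remove.prems(2,3) by (blast intro: peelable.remove)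
qed

lemma peelable_conversep:
  assumes "peelable D U le A"
  shows "peelable U D le\<inverse>\<inverse> A"
  using assms
proof induction
  case (remove x A)
  then show ?case
    using peelable.remove[of x A U "le\<inverse>\<inverse>" D] unfolding conversep_simps[of le] by blast
qed (rule peelable.singleton)

text \<open>
  A point that is minimal among those other than the least element \<open>m\<close> has only \<open>m\<close> strictly
  below it, so it is a beat point, and \<open>m\<close> is still least after its removal.
\<close>

lemma dismantlable_if_has_least:
  assumes "finite_poset A le" "has_least le A"
  shows "dismantlable le A"
  using assms
proof (induction "card A" arbitrary: A rule: less_induct)
  case less
  interpret finite_poset A le by fact
  obtain m where m: "m \<in> A" "\<forall>y\<in>A. le m y"
    using less.prems(2) by (auto simp: has_least_def)
  show ?case
  proof (cases "A = {m}")
    case True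
    then show ?thesis by (auto intro: peelable.singleton)
  next
    case False
    let ?lt = "\<lambda>x y. le x y \<and> x \<noteq> y"
    have "asymp_on (A - {m}) ?lt" "transp_on (A - {m}) ?lt"
      by (auto intro!: asymp_onI transp_onI dest: antisym trans)
    then obtain x where x: "x \<in> A" "x \<noteq> m" "\<forall>y\<in>A - {m}. y \<noteq> x \<longrightarrow> \<not> ?lt y x"
      using Finite_Set.bex_min_element[of "A - {m}" ?lt] False finite m(1) by auto
    then have "strictly_below le A x = {m}"
      using m by (auto simp: strictly_below_def)
    then have "has_greatest le (strictly_below le A x)"
      using m refl by (simp add: has_greatest_def)
    moreover have "dismantlable le (A - {x})"
    proof (rule less.hyps)
      show "card (A - {x}) < card A"
        using x finite by (meson card_Diff1_less)
      show "finite_poset (A - {x}) le"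
        using less.prems(1) by (rule finite_poset_subset) auto
      show "has_least le (A - {x})"
        using m x(2) by (auto simp: has_least_def)
    qed
    ultimately show ?thesis
      using x(1) by (blast intro: peelable.remove)
  qed
qed

lemma dismantlable_if_has_greatest:
  assumes "finite_poset A le" "has_greatest le A"
  shows "dismantlable le A"
proof -
  have "dismantlable le\<inverse>\<inverse> A"
    using assms by (intro dismantlable_if_has_least finite_poset_conversep)
      (simp_all only: conversep_simps[of le])
  from peelable_conversep[OF this] show ?thesis
    unfolding conversep_simps[of le] conversep_conversep .
qed

section \<open>Reductions of a join\<close>

lemma finite_poset_spec_le:
  assumes "finite (topspace X)" "t0_space X"
  shows "finite_poset (topspace X) (spec_le X)"
proof
  show "finite (topspace X)" by fact
  show "spec_le X x x" if "x \<in> topspace X" for x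
    using that by (simp add: spec_le_def min_open_def)
  show "spec_le X x z" if "spec_le X x y" "spec_le X y z" for x y z
    using that by (auto simp: spec_le_def min_open_def)
  show "x = y" if "spec_le X x y" "spec_le X y x" for x y
  proof (rule ccontr)
    assume "x \<noteq> y"
    moreover have "x \<in> topspace X" "y \<in> topspace X"
      using that(1) by (simp_all add: spec_le_def)
    ultimately obtain U where "openin X U" "x \<in> U \<longleftrightarrow> y \<notin> U"
      using assms(2) unfolding t0_space_def by blast
    then show False
      using that by (auto simp: spec_le_def min_open_def)
  qed
qed

lemma finite_poset_join_le:
  assumes "finite_poset (topspace X) (spec_le X)" "finite_poset (topspace Y) (spec_le Y)"
  shows "finite_poset (topspace X <+> topspace Y) (join_le X Y)"
proof -
  interpret X: finite_poset "topspace X" "spec_le X" by fact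
  interpret Y: finite_poset "topspace Y" "spec_le Y" by fact
  show ?thesis
  proof
    show "finite (topspace X <+> topspace Y)"
      using X.finite Y.finite by simp
    show "join_le X Y x x" if "x \<in> topspace X <+> topspace Y" for x
      using that X.refl Y.refl by (cases x) auto
    show "join_le X Y x z" if "x \<in> topspace X <+> topspace Y" "y \<in> topspace X <+> topspace Y"
      "z \<in> topspace X <+> topspace Y" "join_le X Y x y" "join_le X Y y z" for x y z
      using that X.trans[of "projl x" "projl y" "projl z"] Y.trans[of "projr x" "projr y" "projr z"]
      by (cases x; cases y; cases z) auto
    show "x = y" if "x \<in> topspace X <+> topspace Y" "y \<in> topspace X <+> topspace Y"
      "join_le X Y x y" "join_le X Y y x" for x y
      using that X.antisym[of "projl x" "projl y"] Y.antisym[of "projr x" "projr y"]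
      by (cases x; cases y) auto
  qed
qed

lemma below_above_join:
  assumes "A \<subseteq> topspace X" "B \<subseteq> topspace Y"
  shows "x \<in> A \<Longrightarrow> strictly_below (join_le X Y) (A <+> B) (Inl x) = strictly_below (spec_le X) A x <+> {}"
    and "x \<in> A \<Longrightarrow> strictly_above (join_le X Y) (A <+> B) (Inl x) = strictly_above (spec_le X) A x <+> B"
    and "y \<in> B \<Longrightarrow> strictly_below (join_le X Y) (A <+> B) (Inr y) = A <+> strictly_below (spec_le Y) B y"
    and "y \<in> B \<Longrightarrow> strictly_above (join_le X Y) (A <+> B) (Inr y) = {} <+> strictly_above (spec_le Y) B y"
  using assms by (auto simp: strictly_below_def strictly_above_def)

lemma Plus_Diff_singleton:
  "(A <+> B) - {Inl x} = (A - {x}) <+> B" "(A <+> B) - {Inr y} = A <+> (B - {y})"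
  by auto

text \<open>
  A point of \<open>A\<close> may be removable from the join because its punctured up-set there, a join with
  second factor \<open>B\<close>, satisfies \<open>UJ\<close> on account of \<open>UY B\<close> alone; this says nothing about \<open>A\<close>,
  and \<open>U_peelable\<close> is what settles this case, as \<open>D_peelable\<close> does for points of \<open>B\<close>.  The rules
  \<open>D_left\<close> and \<open>U_right\<close> are restricted to an empty other factor, unlike \<open>D_right\<close> and \<open>U_left\<close>,
  because a greatest element of \<open>A\<close> is not one of a join with nonempty \<open>B\<close>.
\<close>

lemma peelable_join_iff:
  assumes AB: "A \<subseteq> topspace X" "B \<subseteq> topspace Y"
    and D_join: "\<And>A B. A \<subseteq> topspace X \<Longrightarrow> B \<subseteq> topspace Y \<Longrightarrow> DJ (A <+> B) \<Longrightarrow> DX A \<or> DY B"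
    and U_join: "\<And>A B. A \<subseteq> topspace X \<Longrightarrow> B \<subseteq> topspace Y \<Longrightarrow> UJ (A <+> B) \<Longrightarrow> UX A \<or> UY B"
    and D_empty: "\<not> DY {}" and U_empty: "\<not> UX {}"
    and D_left: "\<And>A. A \<subseteq> topspace X \<Longrightarrow> DX A \<Longrightarrow> DJ (A <+> {})"
    and D_right: "\<And>A B. A \<subseteq> topspace X \<Longrightarrow> B \<subseteq> topspace Y \<Longrightarrow> DY B \<Longrightarrow> DJ (A <+> B)"
    and U_left: "\<And>A B. A \<subseteq> topspace X \<Longrightarrow> B \<subseteq> topspace Y \<Longrightarrow> UX A \<Longrightarrow> UJ (A <+> B)"
    and U_right: "\<And>B. B \<subseteq> topspace Y \<Longrightarrow> UY B \<Longrightarrow> UJ ({} <+> B)"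
    and D_peelable: "\<And>A. A \<subseteq> topspace X \<Longrightarrow> DX A \<Longrightarrow> peelable DX UX (spec_le X) A"
    and U_peelable: "\<And>B. B \<subseteq> topspace Y \<Longrightarrow> UY B \<Longrightarrow> peelable DY UY (spec_le Y) B"
    and cone: "\<And>S. S \<subseteq> topspace X <+> topspace Y \<Longrightarrow>
      has_least (join_le X Y) S \<or> has_greatest (join_le X Y) S \<Longrightarrow> peelable DJ UJ (join_le X Y) S"
    and refl: "\<And>x. x \<in> topspace X \<Longrightarrow> spec_le X x x" "\<And>y. y \<in> topspace Y \<Longrightarrow> spec_le Y y y"
  shows "peelable DJ UJ (join_le X Y) (A <+> B) \<longleftrightarrow>
    peelable DX UX (spec_le X) A \<or> peelable DY UY (spec_le Y) B"
    (is "?J (A <+> B) \<longleftrightarrow> ?X A \<or> ?Y B")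
proof
  assume "?J (A <+> B)"
  then show "?X A \<or> ?Y B"
    using AB
  proof (induction "A <+> B" arbitrary: A B)
    case (singleton s)
    show ?case
    proof (cases s)
      case (Inl a)
      then have "A = {a}" using singleton by blast
      then show ?thesis by (simp add: peelable.singleton)
    next
      case (Inr b)
      then have "B = {b}" using singleton by blast
      then show ?thesis by (simp add: peelable.singleton)
    qed
  next
    case (remove s)
    note sub = below_above_subset[of "spec_le X" A] below_above_subset[of "spec_le Y" B]
    show ?case
    proof (cases s)
      case (Inl x)
      then have x: "x \<in> A" using remove.hyps(1) by auto
      have IH: "?X (A - {x}) \<or> ?Y B"
        using remove.hyps(4)[of "A - {x}" B] remove.prems Inl Plus_Diff_singleton(1) by blast
      have "DJ (strictly_below (spec_le X) A x <+> {}) \<or> UJ (strictly_above (spec_le X) A x <+> B)"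
        using remove.hyps(2) by (simp only: Inl below_above_join[OF remove.prems] x)
      then have "DX (strictly_below (spec_le X) A x) \<or> UX (strictly_above (spec_le X) A x) \<or> UY B"
        using D_join[of "strictly_below (spec_le X) A x" "{}"] U_join[of "strictly_above (spec_le X) A x" B]
          D_empty sub remove.prems by blast
      then show ?thesis
        using IH U_peelable remove.prems(2) peelable.remove[OF x] by blast
    next
      case (Inr y)
      then have y: "y \<in> B" using remove.hyps(1) by auto
      have IH: "?X A \<or> ?Y (B - {y})"
        using remove.hyps(4)[of A "B - {y}"] remove.prems Inr Plus_Diff_singleton(2) by blast
      have "DJ (A <+> strictly_below (spec_le Y) B y) \<or> UJ ({} <+> strictly_above (spec_le Y) B y)"
        using remove.hyps(2) by (simp only: Inr below_above_join[OF remove.prems] y)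
      then have "DY (strictly_below (spec_le Y) B y) \<or> UY (strictly_above (spec_le Y) B y) \<or> DX A"
        using D_join[of A "strictly_below (spec_le Y) B y"] U_join[of "{}" "strictly_above (spec_le Y) B y"]
          U_empty sub remove.prems by blast
      then show ?thesis
        using IH D_peelable remove.prems(1) peelable.remove[OF y] by blast
    qed
  qed
next
  have "?J (A <+> B)" if "?X A"
    using that AB
  proof induction
    case (singleton a)
    \<comment> \<open>What remains is a cone with apex \<open>a\<close> below all of \<open>B\<close>.\<close>
    have "has_least (join_le X Y) ({a} <+> B)"
      using singleton refl unfolding has_least_def by (intro bexI[of _ "Inl a"]) auto
    then show ?case
      using singleton by (intro cone) auto
  next
    case (remove x A)
    note sub = below_above_subset[of "spec_le X" A x]
    have "DJ (strictly_below (spec_le X) A x <+> {}) \<or> UJ (strictly_above (spec_le X) A x <+> B)"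
      using remove sub D_left U_left by (meson order_trans)
    moreover have "?J (A <+> B - {Inl x})"
      unfolding Plus_Diff_singleton using remove by blast
    ultimately show ?case
      using peelable.remove[of "Inl x" "A <+> B" DJ "join_le X Y" UJ] remove.hyps(1)
      unfolding below_above_join(1,2)[OF remove.prems remove.hyps(1)] by blast
  qed
  moreover have "?J (A <+> B)" if "?Y B"
    using that AB
  proof induction
    case (singleton b)
    have "has_greatest (join_le X Y) (A <+> {b})"
      using singleton refl unfolding has_greatest_def by (intro bexI[of _ "Inr b"]) auto
    then show ?case
      using singleton by (intro cone) auto
  next
    case (remove y B)
    note sub = below_above_subset[of "spec_le Y" B y]
    have "DJ (A <+> strictly_below (spec_le Y) B y) \<or> UJ ({} <+> strictly_above (spec_le Y) B y)"
      using remove sub D_right U_right by (meson order_trans)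
    moreover have "?J (A <+> B - {Inr y})"
      unfolding Plus_Diff_singleton using remove by blast
    ultimately show ?case
      using peelable.remove[of "Inr y" "A <+> B" DJ "join_le X Y" UJ] remove.hyps(1)
      unfolding below_above_join(3,4)[OF remove.prems remove.hyps(1)] by blast
  qed
  ultimately show "?X A \<or> ?Y B \<Longrightarrow> ?J (A <+> B)" by blast
qed

lemma ball_Plus: "(\<forall>s\<in>A <+> B. P s) \<longleftrightarrow> (\<forall>a\<in>A. P (Inl a)) \<and> (\<forall>b\<in>B. P (Inr b))"
  by auto

lemma bex_Plus: "(\<exists>s\<in>A <+> B. P s) \<longleftrightarrow> (\<exists>a\<in>A. P (Inl a)) \<or> (\<exists>b\<in>B. P (Inr b))"
  by auto

lemma has_greatest_join_iff:
  assumes "A \<subseteq> topspace X" "B \<subseteq> topspace Y"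
  shows "has_greatest (join_le X Y) (A <+> B) \<longleftrightarrow>
    (if B = {} then has_greatest (spec_le X) A else has_greatest (spec_le Y) B)"
  using assms unfolding has_greatest_def ball_Plus bex_Plus by (auto simp: subset_iff)

lemma has_least_join_iff:
  assumes "A \<subseteq> topspace X" "B \<subseteq> topspace Y"
  shows "has_least (join_le X Y) (A <+> B) \<longleftrightarrow>
    (if A = {} then has_least (spec_le Y) B else has_least (spec_le X) A)"
  using assms unfolding has_least_def ball_Plus bex_Plus by (auto simp: subset_iff)

lemma has_greatest_has_least_empty [simp]: "\<not> has_greatest le {}" "\<not> has_least le {}"
  by (simp_all add: has_greatest_def has_least_def)

lemma not_dismantlable_empty: "\<not> dismantlable le {}"
  by (auto elim: peelable.cases)

lemma dismantlable_join_iff: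
  assumes X: "finite_poset (topspace X) (spec_le X)"
    and Y: "finite_poset (topspace Y) (spec_le Y)"
    and AB: "A \<subseteq> topspace X" "B \<subseteq> topspace Y"
  shows "dismantlable (join_le X Y) (A <+> B) \<longleftrightarrow>
    dismantlable (spec_le X) A \<or> dismantlable (spec_le Y) B"
proof (rule peelable_join_iff[OF AB], goal_cases)
  case (1 A B) then show ?case by (auto simp: has_greatest_join_iff split: if_splits)
next
  case (2 A B) then show ?case by (auto simp: has_least_join_iff split: if_splits)
next
  case 3 show ?case by simp
next
  case 4 show ?case by simp
next
  case (5 A) then show ?case by (simp add: has_greatest_join_iff)
next
  case (6 A B) then show ?case by (auto simp: has_greatest_join_iff)
next
  case (7 A B) then show ?case by (auto simp: has_least_join_iff)
next
  case (8 B) then show ?case by (simp add: has_least_join_iff)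
next
  case (9 A) then show ?case
    using finite_poset_subset[OF X] by (blast intro: dismantlable_if_has_greatest)
next
  case (10 B) then show ?case
    using finite_poset_subset[OF Y] by (blast intro: dismantlable_if_has_least)
next
  case (11 S) then show ?case
    using finite_poset_subset[OF finite_poset_join_le[OF X Y]]
    by (blast intro: dismantlable_if_has_least dismantlable_if_has_greatest)
qed (auto intro: finite_poset.refl X Y)

text \<open>
  Weak points in terms of the order: dismantlability of the punctured sets stands for their
  contractibility.
\<close>

abbreviation collapsible_poset :: "('a \<Rightarrow> 'a \<Rightarrow> bool) \<Rightarrow> 'a set \<Rightarrow> bool" where
  "collapsible_poset le \<equiv> peelable (dismantlable le) (dismantlable le) le"

text \<open>
  Every beat point is a weak point, since a set with a greatest or a least element is dismantlable.
\<close>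

lemma dismantlable_imp_collapsible_poset:
  assumes "finite_poset A le" "dismantlable le A"
  shows "collapsible_poset le A"
proof (rule peelable_mono[OF assms(2,1)])
  fix B assume "B \<subseteq> A"
  then have "finite_poset B le" by (rule finite_poset_subset[OF assms(1)])
  then show "has_greatest le B \<Longrightarrow> dismantlable le B" "has_least le B \<Longrightarrow> dismantlable le B"
    by (simp_all add: dismantlable_if_has_greatest dismantlable_if_has_least)
qed

lemma collapsible_poset_join_iff:
  assumes X: "finite_poset (topspace X) (spec_le X)"
    and Y: "finite_poset (topspace Y) (spec_le Y)"
  shows "collapsible_poset (join_le X Y) (topspace X <+> topspace Y) \<longleftrightarrow>
    collapsible_poset (spec_le X) (topspace X) \<or> collapsible_poset (spec_le Y) (topspace Y)"
proof -
  note J = finite_poset_join_le[OF X Y]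
  show ?thesis
  proof (rule peelable_join_iff, goal_cases)
    case (11 A) then show ?case
      using finite_poset_subset[OF X] by (blast intro: dismantlable_imp_collapsible_poset)
  next
    case (12 B) then show ?case
      using finite_poset_subset[OF Y] by (blast intro: dismantlable_imp_collapsible_poset)
  next
    case (13 S) then show ?case
      using finite_poset_subset[OF J]
      by (blast intro: dismantlable_imp_collapsible_poset
          dismantlable_if_has_least dismantlable_if_has_greatest)
  qed (auto simp: dismantlable_join_iff[OF X Y] not_dismantlable_empty
      intro: finite_poset.refl[OF X] finite_poset.refl[OF Y])
qed

section \<open>Contractible finite spaces are the dismantlable ones\<close>

context finite_poset
begin

abbreviation space :: "'a topology" where
  "space \<equiv> downset_topology A le"

lemma openin_downset: "x \<in> A \<Longrightarrow> openin space {y \<in> A. le y x}"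
  unfolding openin_downset_topology using trans[of _ _ x] by blast

lemma continuous_map_iff_mono:
  "continuous_map space space f \<longleftrightarrow>
    f ` A \<subseteq> A \<and> (\<forall>x\<in>A. \<forall>y\<in>A. le x y \<longrightarrow> le (f x) (f y))"
proof (intro iffI conjI ballI impI)
  assume f: "continuous_map space space f"
  then show "f ` A \<subseteq> A"
    by (auto simp: continuous_map_def)
  fix x y assume xy: "x \<in> A" "y \<in> A" "le x y"
  then have "f y \<in> A"
    using f by (auto simp: continuous_map_def)
  then have "openin space {z \<in> A. f z \<in> {w \<in> A. le w (f y)}}"
    using openin_continuous_map_preimage[OF f openin_downset] by simp
  moreover have "y \<in> {z \<in> A. f z \<in> {w \<in> A. le w (f y)}}"
    using xy \<open>f y \<in> A\<close> refl by simp
  ultimately have "x \<in> {z \<in> A. f z \<in> {w \<in> A. le w (f y)}}"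
    using xy unfolding openin_downset_topology by blast
  then show "le (f x) (f y)" by simp
next
  assume f: "f ` A \<subseteq> A \<and> (\<forall>x\<in>A. \<forall>y\<in>A. le x y \<longrightarrow> le (f x) (f y))"
  have "openin space {x \<in> A. f x \<in> U}" if "openin space U" for U
    using that f unfolding openin_downset_topology by blast
  then show "continuous_map space space f"
    using f by (auto simp: continuous_map_def)
qed

text \<open>
  The homotopy stays at \<open>f\<close> and jumps to \<open>g\<close> at the very end.  This is continuous because the
  preimage under \<open>g\<close> of an open set, being a down-set, is contained in its preimage under \<open>f\<close>.
\<close>

lemma homotopic_if_le:
  assumes f: "continuous_map space space f" and g: "continuous_map space space g"
    and le: "\<And>x. x \<in> A \<Longrightarrow> le (f x) (g x)"
  shows "homotopic_with (\<lambda>_. True) space space f g"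
proof -
  define h where "h = (\<lambda>(t::real, x). if t = 1 then g x else f x)"
  let ?I = "top_of_set {0..1::real}"
  have "continuous_map (prod_topology ?I space) space h"
    unfolding continuous_map_def
  proof (intro conjI allI impI)
    show "h \<in> topspace (prod_topology ?I space) \<rightarrow> topspace space"
      using f g by (auto simp: h_def continuous_map_def)
    fix U assume U: "openin space U"
    let ?F = "{x \<in> topspace space. f x \<in> U}" and ?G = "{x \<in> topspace space. g x \<in> U}"
    have "f x \<in> U" if "x \<in> A" "g x \<in> U" for x
    proof -
      have "f x \<in> A" using f that(1) by (auto simp: continuous_map_def)
      then show ?thesis
        using U le[OF that(1)] that(2) unfolding openin_downset_topology by blast
    qed
    then have "{p \<in> topspace (prod_topology ?I space). h p \<in> U} = {0..<1} \<times> ?F \<union> {0..1} \<times> ?G"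
      by (auto simp: h_def split: if_splits)
    moreover have "openin ?I {0..<1}"
      unfolding openin_open by (intro exI[of _ "{..<1}"]) auto
    moreover have "openin ?I {0..1}"
      by (metis openin_topspace topspace_euclidean_subtopology)
    ultimately show "openin (prod_topology ?I space) {p \<in> topspace (prod_topology ?I space). h p \<in> U}"
      using openin_continuous_map_preimage[OF f U] openin_continuous_map_preimage[OF g U]
      by (simp add: openin_prod_Times_iff openin_Un)
  qed
  then show ?thesis
    unfolding homotopic_with_def by (intro exI[of _ h]) (auto simp: h_def)
qed

definition beat_point :: "'a \<Rightarrow> bool" where
  "beat_point x \<longleftrightarrow> x \<in> A \<and> (has_greatest le (strictly_below le A x) \<or> has_least le (strictly_above le A x))"

text \<open>
  The retraction sends the beat point to the greatest point strictly below it or the least point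
  strictly above it; the extremality of that point is what makes the map monotone.
\<close>

lemma beat_point_retraction:
  assumes "beat_point x"
  obtains r where "continuous_map space space r" "r ` A \<subseteq> A - {x}"
    "\<And>y. y \<in> A - {x} \<Longrightarrow> r y = y"
    "(\<forall>y\<in>A. le (r y) y) \<or> (\<forall>y\<in>A. le y (r y))"
proof -
  have x: "x \<in> A" using assms by (simp add: beat_point_def)
  consider (down) m where "m \<in> A" "m \<noteq> x" "le m x" "\<And>y. y \<in> A \<Longrightarrow> le y x \<Longrightarrow> y \<noteq> x \<Longrightarrow> le y m"
    | (up) m where "m \<in> A" "m \<noteq> x" "le x m" "\<And>y. y \<in> A \<Longrightarrow> le x y \<Longrightarrow> y \<noteq> x \<Longrightarrow> le m y"
    using assms by (auto simp: beat_point_def has_greatest_def has_least_def strictly_below_def strictly_above_def)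
  then show ?thesis
  proof cases
    case down
    show ?thesis
    proof (rule that[of "\<lambda>y. if y = x then m else y"])
      show "continuous_map space space (\<lambda>y. if y = x then m else y)"
        unfolding continuous_map_iff_mono using x down
        by (auto intro: refl trans[OF \<open>m \<in> A\<close> x])
    qed (use x down refl in auto)
  next
    case up
    show ?thesis
    proof (rule that[of "\<lambda>y. if y = x then m else y"])
      show "continuous_map space space (\<lambda>y. if y = x then m else y)"
        unfolding continuous_map_iff_mono using x up
        by (auto intro: refl trans[OF _ x \<open>m \<in> A\<close>])
    qed (use x up refl in auto)
  qed
qed

lemma subtopology_downset:
  assumes "B \<subseteq> A"
  shows "subtopology space B = downset_topology B le"
proof -
  have "openin (subtopology space B) W \<longleftrightarrow> openin (downset_topology B le) W" for W
  proof
    assume "openin (subtopology space B) W"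
    then show "openin (downset_topology B le) W"
      using assms by (auto simp: openin_subtopology openin_downset_topology)
  next
    assume W: "openin (downset_topology B le) W"
    let ?U = "{y \<in> A. \<exists>w\<in>W. le y w}"
    have "openin space ?U"
      using W assms unfolding openin_downset_topology by (blast intro: trans)
    moreover have "W = ?U \<inter> B"
      using W assms refl unfolding openin_downset_topology by blast
    ultimately show "openin (subtopology space B) W"
      unfolding openin_subtopology by blast
  qed
  then show ?thesis by (simp add: topology_eq)
qed

lemma contractible_remove_beat_point_iff:
  assumes "beat_point x"
  shows "contractible_space (downset_topology (A - {x}) le) \<longleftrightarrow> contractible_space space"
proof -
  obtain r where r: "continuous_map space space r" "r ` A \<subseteq> A - {x}"
    "\<And>y. y \<in> A - {x} \<Longrightarrow> r y = y" "(\<forall>y\<in>A. le (r y) y) \<or> (\<forall>y\<in>A. le y (r y))"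
    using beat_point_retraction[OF assms] by blast
  let ?S = "subtopology space (A - {x})"
  have S: "downset_topology (A - {x}) le = ?S"
    by (simp add: subtopology_downset)
  have rS: "continuous_map space ?S r"
    using r(1,2) by (auto simp: continuous_map_in_subtopology)
  have inc: "continuous_map ?S space id"
    by (simp add: continuous_map_from_subtopology)
  have "homotopic_with (\<lambda>_. True) space space r id"
    using r(4) homotopic_if_le[OF r(1) continuous_map_id] homotopic_if_le[OF continuous_map_id r(1)]
    by (auto simp: homotopic_with_sym)
  moreover have "homotopic_with (\<lambda>_. True) ?S ?S (r \<circ> id) id"
    by (rule homotopic_with_equal)
      (use r(3) continuous_map_compose[OF inc rS] in \<open>auto simp: topspace_subtopology_subset\<close>)
  ultimately have "space homotopy_equivalent_space ?S"
    unfolding homotopy_equivalent_space_def using rS inc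
    by (intro exI[of _ r] exI[of _ id]) simp
  then show ?thesis
    using S homotopy_equivalent_space_contractibility by metis
qed

text \<open>
  Rigidity: if \<open>z\<close> is a minimal point moved by \<open>f\<close>, then \<open>f\<close> fixes every \<open>y < z\<close>, whence
  \<open>y = f y \<le> f z < z\<close>.  So \<open>f z\<close> is the greatest point strictly below \<open>z\<close>, and \<open>z\<close> is a beat point.
\<close>

lemma map_below_identity_eq:
  assumes "\<nexists>x. beat_point x" "continuous_map space space f"
    and "\<And>x. x \<in> A \<Longrightarrow> le (f x) x" "x \<in> A"
  shows "f x = x"
proof (rule ccontr)
  assume "f x \<noteq> x"
  let ?M = "{y \<in> A. f y \<noteq> y}" and ?lt = "\<lambda>x y. le x y \<and> x \<noteq> y"
  have "asymp_on ?M ?lt" "transp_on ?M ?lt"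
    by (auto intro!: asymp_onI transp_onI dest: antisym trans)
  then obtain z where z: "z \<in> A" "f z \<noteq> z" "\<And>y. y \<in> A \<Longrightarrow> f y \<noteq> y \<Longrightarrow> y \<noteq> z \<Longrightarrow> \<not> le y z"
    using Finite_Set.bex_min_element[of ?M ?lt] \<open>x \<in> A\<close> \<open>f x \<noteq> x\<close> finite by auto
  have "has_greatest le (strictly_below le A z)"
    unfolding has_greatest_def
  proof (intro bexI[of _ "f z"] ballI)
    show "f z \<in> strictly_below le A z"
      using assms(2,3) z by (auto simp: strictly_below_def continuous_map_iff_mono)
    fix y assume "y \<in> strictly_below le A z"
    then have "f y = y" "le (f y) (f z)"
      using z assms(2) by (auto simp: strictly_below_def continuous_map_iff_mono)
    then show "le y (f z)" by simp
  qed
  then show False using assms(1) z(1) by (auto simp: beat_point_def)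
qed

text \<open>
  Reversing the order changes neither the continuous self-maps, which are the monotone ones, nor the
  beat points.
\<close>

lemma map_above_identity_eq:
  assumes "\<nexists>x. beat_point x" "continuous_map space space f"
    and "\<And>x. x \<in> A \<Longrightarrow> le x (f x)" "x \<in> A"
  shows "f x = x"
proof -
  interpret dual: finite_poset A "le\<inverse>\<inverse>"
    by (rule finite_poset_conversep) unfold_locales
  show ?thesis
  proof (rule dual.map_below_identity_eq)
    show "\<nexists>x. dual.beat_point x"
      using assms(1) unfolding beat_point_def dual.beat_point_def conversep_simps[of le] by blast
    show "continuous_map dual.space dual.space f"
      using assms(2) unfolding continuous_map_iff_mono dual.continuous_map_iff_mono conversep_iff
      by blast
    show "le\<inverse>\<inverse> (f y) y" if "y \<in> A" for y
      unfolding conversep_iff using that by (rule assms(3))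
  qed (rule assms(4))
qed

text \<open>
  The identity cannot be deformed at all: the times \<open>T\<close> at which a null homotopy of the identity is
  still the identity form a clopen subset of the unit interval.
\<close>

lemma singleton_if_contractible_no_beat_point:
  assumes contr: "contractible_space space" and nonempty: "A \<noteq> {}" and no_beat: "\<nexists>x. beat_point x"
  shows "\<exists>a. A = {a}"
proof -
  let ?I = "top_of_set {0..1::real}"
  obtain a h where h: "continuous_map (prod_topology ?I space) space h"
    "\<And>x. h (0, x) = x" "\<And>x. h (1, x) = a"
    using contr unfolding contractible_space_def homotopic_with_def by auto
  have h_space: "continuous_map space space (\<lambda>x. h (t, x))" if "t \<in> {0..1}" for t
    by (rule continuous_map_compose[OF _ h(1), unfolded o_def])
      (use that in \<open>auto simp: continuous_map_pairwise o_def\<close>)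
  have h_time: "continuous_map ?I space (\<lambda>t. h (t, x))" if "x \<in> A" for x
    by (rule continuous_map_compose[OF _ h(1), unfolded o_def])
      (use that in \<open>auto simp: continuous_map_pairwise o_def\<close>)
  have hA: "h (t, x) \<in> A" if "t \<in> {0..1}" "x \<in> A" for t x
    using h_space[OF that(1)] that(2) by (auto simp: continuous_map_iff_mono)
  \<comment> \<open>For each of the finitely many \<open>x\<close>, the points below \<open>h (t, x)\<close> form an open set.\<close>
  have near: "\<exists>N. openin ?I N \<and> t \<in> N \<and> (\<forall>s\<in>N. \<forall>x\<in>A. le (h (s, x)) (h (t, x)))"
    if t: "t \<in> {0..1}" for t
  proof (intro exI[of _ "\<Inter>x\<in>A. {s \<in> topspace ?I. h (s, x) \<in> {y \<in> A. le y (h (t, x))}}"] conjI)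
    show "openin ?I (\<Inter>x\<in>A. {s \<in> topspace ?I. h (s, x) \<in> {y \<in> A. le y (h (t, x))}})"
      using finite nonempty hA[OF t]
      by (intro openin_INT2 openin_continuous_map_preimage[OF h_time] openin_downset)
  qed (use t hA refl in auto)
  define T where "T = {t \<in> {0..1}. \<forall>x\<in>A. h (t, x) = x}"
  have "openin ?I T"
  proof (subst openin_subopen, intro ballI)
    fix t assume "t \<in> T"
    then have t: "t \<in> {0..1}" "\<And>x. x \<in> A \<Longrightarrow> h (t, x) = x" by (auto simp: T_def)
    obtain N where N: "openin ?I N" "t \<in> N" "\<And>s x. s \<in> N \<Longrightarrow> x \<in> A \<Longrightarrow> le (h (s, x)) x"
      using near[OF t(1)] t(2) by force
    \<comment> \<open>Near \<open>t\<close> the maps lie below the identity.\<close>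
    have "N \<subseteq> T"
    proof
      fix s assume s: "s \<in> N"
      then have s01: "s \<in> {0..1}" using openin_subset[OF N(1)] by auto
      then show "s \<in> T"
        using map_below_identity_eq[OF no_beat h_space[OF s01]] N(3)[OF s] by (simp add: T_def)
    qed
    then show "\<exists>N. openin ?I N \<and> t \<in> N \<and> N \<subseteq> T" using N by blast
  qed
  moreover have "openin ?I ({0..1} - T)"
  proof (subst openin_subopen, intro ballI)
    fix t assume "t \<in> {0..1} - T"
    then have t: "t \<in> {0..1}" "t \<notin> T" by auto
    obtain N where N: "openin ?I N" "t \<in> N" "\<And>s x. s \<in> N \<Longrightarrow> x \<in> A \<Longrightarrow> le (h (s, x)) (h (t, x))"
      using near[OF t(1)] by blast
    \<comment> \<open>An identity map near \<open>t\<close> would place the map at time \<open>t\<close> above the identity.\<close>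
    have "s \<notin> T" if s: "s \<in> N" for s
    proof
      assume "s \<in> T"
      then have "\<And>x. x \<in> A \<Longrightarrow> le x (h (t, x))"
        using N(3)[OF s] by (force simp: T_def)
      then have "t \<in> T"
        using map_above_identity_eq[OF no_beat h_space[OF t(1)]] t(1) by (simp add: T_def)
      then show False using t(2) by simp
    qed
    then show "\<exists>N. openin ?I N \<and> t \<in> N \<and> N \<subseteq> {0..1} - T"
      using N openin_subset[OF N(1)] by auto
  qed
  ultimately have "T = {} \<or> T = {0..1}"
    using connected_Icc[of 0 "1::real"] unfolding connected_clopen closedin_def
    by (metis openin_imp_subset topspace_euclidean_subtopology)
  moreover have "0 \<in> T" by (simp add: T_def h(2))
  ultimately have "1 \<in> T" by auto
  then show ?thesis using h(3) nonempty by (auto simp: T_def)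
qed

end

text \<open>
  Removing a beat point changes nothing about contractibility, so a contractible space can be stripped
  of beat points until none is left, and what remains is a single point; conversely, contractibility
  passes from the point back up along a dismantling.
\<close>

lemma contractible_iff_dismantlable:
  assumes "finite_poset A le"
  shows "contractible_to_point (downset_topology A le) \<longleftrightarrow> dismantlable le A"
  unfolding contractible_to_point_iff topspace_downset_topology
proof
  assume "contractible_space (downset_topology A le) \<and> A \<noteq> {}"
  with assms show "dismantlable le A"
  proof (induction "card A" arbitrary: A rule: less_induct)
    case less
    interpret finite_poset A le by fact
    show ?case
    proof (cases "\<exists>x. beat_point x")
      case True
      then obtain x where x: "beat_point x" by blast
      then have "x \<in> A" by (simp add: beat_point_def)
      have "A - {x} \<noteq> {}"
        using beat_point_retraction[OF x] \<open>x \<in> A\<close>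
        by (metis empty_iff image_subset_iff)
      moreover have "contractible_space (downset_topology (A - {x}) le)"
        using contractible_remove_beat_point_iff[OF x] less.prems(2) by blast
      moreover have "finite_poset (A - {x}) le"
        using less.prems(1) by (rule finite_poset_subset) auto
      moreover have "card (A - {x}) < card A"
        using finite \<open>x \<in> A\<close> by (meson card_Diff1_less)
      ultimately have "dismantlable le (A - {x})"
        using less.hyps by blast
      then show ?thesis
        using x by (auto simp: beat_point_def intro: peelable.remove)
    next
      case False
      then show ?thesis
        using singleton_if_contractible_no_beat_point less.prems(2) by (auto intro: peelable.singleton)
    qed
  qed
next
  assume "dismantlable le A"
  then show "contractible_space (downset_topology A le) \<and> A \<noteq> {}"
    using assms
  proof induction
    case (singleton a)
    show ?case by (auto intro: contractible_space_subset_singleton)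
  next
    case (remove x A)
    interpret finite_poset A le by fact
    have "finite_poset (A - {x}) le"
      using remove.prems(1) by (rule finite_poset_subset) auto
    moreover have "beat_point x"
      using remove.hyps by (simp add: beat_point_def)
    ultimately show ?case
      using remove.IH contractible_remove_beat_point_iff by blast
  qed
qed

section \<open>Collapsible spaces\<close>

context finite_poset
begin

lemma spec_le_downset: "spec_le space x y \<longleftrightarrow> x \<in> A \<and> y \<in> A \<and> le x y"
proof -
  have "x \<in> min_open space y \<longleftrightarrow> le x y" if "x \<in> A" "y \<in> A" for x y
  proof
    assume "x \<in> min_open space y"
    then show "le x y"
      using openin_downset[OF that(2)] refl[OF that(2)] that(2) by (auto simp: min_open_def)
  next
    assume "le x y"
    then show "x \<in> min_open space y"
      using that by (auto simp: min_open_def openin_downset_topology)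
  qed
  then show ?thesis by (auto simp: spec_le_def)
qed

lemma weak_point_iff:
  "weak_point space x \<longleftrightarrow>
    x \<in> A \<and> (dismantlable le (strictly_below le A x) \<or> dismantlable le (strictly_above le A x))"
proof (cases "x \<in> A")
  case True
  have "min_open space x \<subseteq> A"
    using True openin_topspace[of space] by (auto simp: min_open_def)
  then have "min_open space x - {x} = strictly_below le A x"
    using spec_le_downset[of _ x] True by (auto simp: spec_le_def strictly_below_def)
  moreover have "up_set space x - {x} = strictly_above le A x"
    using True by (auto simp: up_set_def spec_le_downset strictly_above_def)
  moreover have "contractible_to_point (subtopology space B) \<longleftrightarrow> dismantlable le B" if "B \<subseteq> A" for B
    using contractible_iff_dismantlable[OF finite_poset_subset[OF finite_poset_axioms that]]
    unfolding subtopology_downset[OF that] .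
  ultimately show ?thesis
    using True by (simp add: weak_point_def below_above_subset)
qed (simp add: weak_point_def)

end

lemma collapsible_iff_collapsible_poset:
  assumes "finite_poset A le"
  shows "collapsible (downset_topology A le) \<longleftrightarrow> collapsible_poset le A"
proof
  assume "collapsible (downset_topology A le)"
  then obtain Z a where "elementary_collapse\<^sup>*\<^sup>* (downset_topology A le) Z" "topspace Z = {a}"
    by (auto simp: collapsible_def collapses_to_def)
  then show "collapsible_poset le A"
    using assms
  proof (induction "downset_topology A le" arbitrary: A rule: converse_rtranclp_induct)
    case base
    then show ?case by (auto intro: peelable.singleton)
  next
    case (step W)
    interpret finite_poset A le by fact
    obtain x where x: "weak_point space x" "W = subtopology space (A - {x})"
      using step.hyps(1) by (auto simp: elementary_collapse_def)
    then have "collapsible_poset le (A - {x})"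
      using step finite_poset_subset[OF finite_poset_axioms] by (simp add: subtopology_downset)
    then show ?case
      using x(1) by (auto simp: weak_point_iff intro: peelable.remove)
  qed
next
  assume "collapsible_poset le A"
  then show "collapsible (downset_topology A le)"
    using assms
  proof induction
    case (singleton a)
    show ?case
      unfolding collapsible_def collapses_to_def by (meson rtranclp.rtrancl_refl topspace_downset_topology)
  next
    case (remove x A)
    interpret finite_poset A le by fact
    have "elementary_collapse space (downset_topology (A - {x}) le)"
      using remove.hyps unfolding elementary_collapse_def
      by (intro exI[of _ x]) (simp add: weak_point_iff subtopology_downset)
    moreover have "collapsible (downset_topology (A - {x}) le)"
      using remove.IH finite_poset_subset[OF finite_poset_axioms] by simp
    ultimately show ?case
      unfolding collapsible_def collapses_to_def by (meson converse_rtranclp_into_rtranclp)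
  qed
qed

theorem proposition3p8:
  fixes X :: "'a topology" and Y :: "'b topology"
  assumes "finite (topspace X)" and "t0_space X"
    and "finite (topspace Y)" and "t0_space Y"
  shows "collapsible (nh_join X Y) \<longleftrightarrow> collapsible X \<or> collapsible Y"
proof -
  note X = finite_poset_spec_le[OF assms(1,2)] and Y = finite_poset_spec_le[OF assms(3,4)]
  have "collapsible X \<longleftrightarrow> collapsible_poset (spec_le X) (topspace X)"
    using collapsible_iff_collapsible_poset[OF X] by (simp add: downset_topology_spec_le assms)
  moreover have "collapsible Y \<longleftrightarrow> collapsible_poset (spec_le Y) (topspace Y)"
    using collapsible_iff_collapsible_poset[OF Y] by (simp add: downset_topology_spec_le assms)
  moreover have "collapsible (nh_join X Y) \<longleftrightarrow>
      collapsible_poset (join_le X Y) (topspace X <+> topspace Y)"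
    unfolding nh_join_def by (rule collapsible_iff_collapsible_poset[OF finite_poset_join_le[OF X Y]])
  ultimately show ?thesis
    using collapsible_poset_join_iff[OF X Y] by simp
qed

end
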